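(* For every legal schedule $W=(w_1,w_2,\ldots,w_{k-1})$, $$P_W(X_k;q)=\sum_{BD\in\mathcal{BD}_W}A_{BD}(q)\,m_{BD}(X_k),$$ where $\mathcal{BD}_W$ is the family of all bar diagrams corresponding to $W$, $A_{BD}(q)$ is the polynomial in $q$ obtained from $BD$, and $m_{BD}(X_k)=\prod_{x_i\in S}x_i$ with $S\subseteq X_k$ the set of elements whose bars are up in $BD$.
   Context: A legal schedule is a (possibly empty) finite sequence of integers $W=(w_1,\ldots,w_{k-1})$, $k\ge 1$, with $1\le w_1\le 2$ and $1\le w_i\le w_{i-1}+1$ for $2\le i\le k-1$. Its alphabet is $X_k=\{x_{-1},x_0,x_1,\ldots,x_{k-1}\}$. Polynomials $P_W(X_k;q)$ are defined recursively: for the empty schedule ($k=1$), $P_{\emptyset}=q\,x_{-1}+x_0$; and for a legal schedule $W=(w_1,\ldots,w_{k-1})$ and an integer $w$ with $1\le w\le w_{k-1}+1$ (for $k=1$: $1\le w\le 2$), letting $W,w$ denote the schedule obtained by appending $w$ to $W$, $$P_{W,w}(X_{k+1};q)=\frac{x_k-q^w}{1-q}P_W(X_k;q)+\frac{1-x_k}{1-q}\Big(P_W(X_k;q)\Big|_{x_{k-i}\to q x_{k-i},\ 1\le i\le w}\Big).$$ Bar diagrams. For $1\le i\le k-1$ bar $x_i$ has $w_i$ cells and acts on bars $x_{i-1},x_{i-2},\ldots,x_{i-w_i}$. Consider an assignment of "up" or "down" to each of the bars $x_{-1},x_0,\ldots,x_{k-1}$ such that exactly one of $x_{-1},x_0$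 is up. For $1\le i\le k-1$ let $a_i$ be the number of up bars among $x_{i-1},\ldots,x_{i-w_i}$. If bar $x_i$ is up, it has $a_i$ yellow cells, with labels $1,q,\ldots,q^{a_i-1}$; if bar $x_i$ is down, it has $w_i-a_i$ yellow cells, with labels $q^{a_i},q^{a_i+1},\ldots,q^{w_i-1}$. The assignment is a bar diagram of $W$ if every bar $x_i$ with $1\le i\le k-1$ has at least one yellow cell. For a bar diagram $BD$, $A_{BD}(q)$ is the product, over $1\le i\le k-1$, of the sum of the labels of the yellow cells of bar $x_i$, multiplied by an extra factor $q$ if bar $x_{-1}$ is up. *)

theory Defs
  imports "HOL-Library.Poly_Mapping" "HOL-Computational_Algebra.Polynomial"
    "HOL-Computational_Algebra.Fraction_Field"
begin

text \<open>
  Polynomials in the variables \<open>x\<^sub>i\<close> (\<open>i\<close> an integer) with coefficients in the field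
  \<open>\<rat>(q)\<close>. A monomial is a finitely supported exponent function, and multiplication
  is the convolution product of \<^type>\<open>poly_mapping\<close>. The division by \<open>1 - q\<close> in the
  recursion for \<open>P\<^sub>W\<close> takes place in \<open>\<rat>(q)\<close>.
\<close>

type_synonym ratfun = "rat poly fract"
type_synonym mpoly = "(int \<Rightarrow>\<^sub>0 nat) \<Rightarrow>\<^sub>0 ratfun"

definition cst :: "ratfun \<Rightarrow> mpoly" where
  "cst c = Poly_Mapping.single 0 c"

definition xvar :: "int \<Rightarrow> mpoly" where
  "xvar i = Poly_Mapping.single (Poly_Mapping.single i 1) 1"

definition qpoly :: "rat poly" where
  "qpoly = [:0, 1:]"

definition of_qpoly :: "rat poly \<Rightarrow> ratfun" where
  "of_qpoly p = Fraction_Field.Fract p 1"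

definition qvar :: ratfun where
  "qvar = of_qpoly qpoly"

text \<open>Simultaneous substitution \<open>x\<^sub>i \<rightarrow> \<sigma> i\<close>, fixing the coefficients.\<close>

definition msubst :: "(int \<Rightarrow> mpoly) \<Rightarrow> mpoly \<Rightarrow> mpoly" where
  "msubst \<sigma> p =
     (\<Sum>m\<in>Poly_Mapping.keys p.
        cst (Poly_Mapping.lookup p m) *
        (\<Prod>i\<in>Poly_Mapping.keys m. \<sigma> i ^ Poly_Mapping.lookup m i))"

text \<open>
  The list \<open>W = [w\<^sub>1, \<dots>, w\<^sub>k\<^sub>-\<^sub>1]\<close> has \<open>W ! j = w\<^sub>j\<^sub>+\<^sub>1\<close>, and \<open>k = length W + 1\<close>.
\<close>

definition legal :: "nat list \<Rightarrow> bool" where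
  "legal W \<longleftrightarrow>
     (W \<noteq> [] \<longrightarrow> 1 \<le> W ! 0 \<and> W ! 0 \<le> 2) \<and>
     (\<forall>j. 1 \<le> j \<and> j < length W \<longrightarrow> 1 \<le> W ! j \<and> W ! j \<le> W ! (j - 1) + 1)"

text \<open>
  The recursion appends entries at the end of the schedule, so it is carried out on the
  reversed list; \<open>P_W_append\<close> below gives it in its original form.
\<close>

primrec P_rev :: "nat list \<Rightarrow> mpoly" where
  "P_rev [] = cst qvar * xvar (-1) + xvar 0"
| "P_rev (w # ws) =
     (let k = int (length ws) + 1 in
        (xvar k - cst (qvar ^ w)) * cst (1 / (1 - qvar)) * P_rev ws +
        (1 - xvar k) * cst (1 / (1 - qvar)) *
          msubst (\<lambda>j. if k - int w \<le> j \<and> j \<le> k - 1 then cst qvar * xvar j else xvar j) (P_rev ws))"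

definition P_W :: "nat list \<Rightarrow> mpoly" where
  "P_W W = P_rev (rev W)"

lemma P_W_Nil: "P_W [] = cst qvar * xvar (-1) + xvar 0"
  by (simp add: P_W_def)

lemma P_W_append:
  assumes "k = int (length W) + 1"
  shows "P_W (W @ [w]) =
     (xvar k - cst (qvar ^ w)) * cst (1 / (1 - qvar)) * P_W W +
     (1 - xvar k) * cst (1 / (1 - qvar)) *
       msubst (\<lambda>j. if k - int w \<le> j \<and> j \<le> k - 1 then cst qvar * xvar j else xvar j) (P_W W)"
  using assms by (simp add: P_W_def Let_def)

lemma one_minus_qvar_nonzero: "1 - qvar \<noteq> 0"
  by (simp add: qvar_def of_qpoly_def qpoly_def One_fract_def Zero_fract_def eq_fract one_pCons)

text \<open>
  An up/down assignment to the bars \<open>x\<^sub>-\<^sub>1, x\<^sub>0, \<dots>, x\<^sub>k\<^sub>-\<^sub>1\<close> is given by the set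
  \<open>S \<subseteq> {-1..k-1}\<close> of indices of its up bars. Note \<open>k - 1 = length W\<close>.
  A yellow cell is represented by the exponent of its label.
\<close>

definition up_count :: "nat list \<Rightarrow> int set \<Rightarrow> nat \<Rightarrow> nat" where
  "up_count W S i = card (S \<inter> {int i - int (W ! (i - 1)) .. int i - 1})"

definition yellow :: "nat list \<Rightarrow> int set \<Rightarrow> nat \<Rightarrow> nat set" where
  "yellow W S i =
     (if int i \<in> S then {0..<up_count W S i} else {up_count W S i..<W ! (i - 1)})"

definition bar_diagrams :: "nat list \<Rightarrow> int set set" where
  "bar_diagrams W =
     {S. S \<subseteq> {-1..int (length W)} \<and> (-1 \<in> S \<longleftrightarrow> 0 \<notin> S) \<and>
         (\<forall>i\<in>{1..length W}. yellow W S i \<noteq> {})}"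

definition A_BD :: "nat list \<Rightarrow> int set \<Rightarrow> rat poly" where
  "A_BD W S =
     (\<Prod>i = 1..length W. \<Sum>e\<in>yellow W S i. qpoly ^ e) * (if -1 \<in> S then qpoly else 1)"

definition m_BD :: "int set \<Rightarrow> mpoly" where
  "m_BD S = (\<Prod>i\<in>S. xvar i)"

end

theory Submission
  imports Defs
begin

text \<open>
  The proof is an induction on the schedule, one appended entry \<open>w\<close> at a time. The substitution
  in the recursion is diagonal on the square-free monomials \<open>m\<^sub>S\<close>: it multiplies \<open>m\<^sub>S\<close> by \<open>q\<^sup>a\<close>,
  where \<open>a\<close> is the number of up bars among the \<open>w\<close> bars that the new bar \<open>x\<^sub>k\<close> acts on. Hence
  the recursion replaces \<open>m\<^sub>S\<close> by
  \[ \frac{x_k - q^w}{1-q} m_S + \frac{(1-x_k)\, q^a}{1-q} m_S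
     = \frac{1-q^a}{1-q}\, x_k m_S + \frac{q^a-q^w}{1-q}\, m_S, \]
  and since \<open>a \<le> w\<close> the two fractions are the geometric sums \<open>1 + \<dots> + q\<^sup>a\<^sup>-\<^sup>1\<close> and
  \<open>q\<^sup>a + \<dots> + q\<^sup>w\<^sup>-\<^sup>1\<close>: the label sums of the yellow cells of \<open>x\<^sub>k\<close> when it is up and when it is
  down (\<open>recursion_on_monomial\<close>). So each assignment of the old bars splits into its two
  extensions to \<open>x\<^sub>k\<close>, with the right weights.

  A bar without yellow cells has label sum \<open>0\<close>. The sum over bar diagrams is therefore the same
  as the sum over all assignments in which exactly one of \<open>x\<^sub>-\<^sub>1, x\<^sub>0\<close> is up
  (\<open>sum_bar_diagrams_eq_assignments\<close>), and it is this larger family that obeys a simple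
  recursion in the length of the schedule.
\<close>

section \<open>Coefficients and geometric sums\<close>

lemma cst_0 [simp]: "cst 0 = 0"
  and cst_1 [simp]: "cst 1 = 1"
  and cst_add: "cst (a + b) = cst a + cst b"
  and cst_diff: "cst (a - b) = cst a - cst b"
  and cst_mult: "cst (a * b) = cst a * cst b"
  by (simp_all add: cst_def single_add single_diff mult_single)

lemma cst_power: "cst (a ^ n) = cst a ^ n"
  by (induction n) (simp_all add: cst_mult)

lemma of_qpoly_0 [simp]: "of_qpoly 0 = 0"
  and of_qpoly_1 [simp]: "of_qpoly 1 = 1"
  and of_qpoly_add: "of_qpoly (a + b) = of_qpoly a + of_qpoly b"
  and of_qpoly_mult: "of_qpoly (a * b) = of_qpoly a * of_qpoly b"
  unfolding of_qpoly_def by (simp_all only: Zero_fract_def One_fract_def) simp_all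

lemma of_qpoly_power: "of_qpoly (a ^ n) = of_qpoly a ^ n"
  by (induction n) (simp_all add: of_qpoly_mult)

lemma of_qpoly_geometric_sum:
  assumes "a \<le> b"
  shows "of_qpoly (\<Sum>e = a..<b. qpoly ^ e) = (qvar ^ a - qvar ^ b) * (1 / (1 - qvar))"
  using assms
proof (induction b rule: dec_induct)
  case base
  show ?case by simp
next
  case (step n)
  have last: "qvar ^ n = (qvar ^ n - qvar ^ Suc n) * (1 / (1 - qvar))"
  proof -
    have "qvar ^ n - qvar ^ Suc n = qvar ^ n * (1 - qvar)"
      by (simp add: algebra_simps)
    then show ?thesis
      using one_minus_qvar_nonzero by simp
  qed
  have "of_qpoly (\<Sum>e = a..<Suc n. qpoly ^ e) = of_qpoly (\<Sum>e = a..<n. qpoly ^ e) + qvar ^ n"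
    using step.hyps by (simp add: of_qpoly_add of_qpoly_power qvar_def)
  also have "\<dots> = (qvar ^ a - qvar ^ n) * (1 / (1 - qvar)) +
      (qvar ^ n - qvar ^ Suc n) * (1 / (1 - qvar))"
    by (simp only: step.IH flip: last)
  also have "\<dots> = (qvar ^ a - qvar ^ Suc n) * (1 / (1 - qvar))"
    unfolding distrib_right[symmetric] by simp
  finally show ?case .
qed

section \<open>Substitution\<close>

text \<open>
  The defining sum of a substitution ranges over the support, which is not additive; over a fixed
  larger index set the summand is linear in \<open>p\<close>.
\<close>

lemma msubst_superset:
  assumes "finite A" "Poly_Mapping.keys p \<subseteq> A"
  shows "msubst \<sigma> p = (\<Sum>m\<in>A. cst (Poly_Mapping.lookup p m) *
           (\<Prod>i\<in>Poly_Mapping.keys m. \<sigma> i ^ Poly_Mapping.lookup m i))"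
  unfolding msubst_def using assms
  by (intro sum.mono_neutral_left) (auto simp: in_keys_iff)

lemma msubst_add: "msubst \<sigma> (p + r) = msubst \<sigma> p + msubst \<sigma> r"
proof -
  let ?A = "Poly_Mapping.keys p \<union> Poly_Mapping.keys r"
  have "Poly_Mapping.keys (p + r) \<subseteq> ?A"
    by (rule keys_add)
  then show ?thesis
    by (simp add: msubst_superset[of ?A] lookup_add cst_add distrib_right sum.distrib)
qed

lemma msubst_0 [simp]: "msubst \<sigma> 0 = 0"
  by (simp add: msubst_def)

lemma msubst_sum: "msubst \<sigma> (sum f A) = (\<Sum>x\<in>A. msubst \<sigma> (f x))"
  by (induction A rule: infinite_finite_induct) (simp_all add: msubst_add)

lemma m_BD_eq_single:
  "m_BD S = Poly_Mapping.single (\<Sum>i\<in>S. Poly_Mapping.single i 1) 1"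
  unfolding m_BD_def
  by (induction S rule: infinite_finite_induct) (simp_all add: xvar_def mult_single)

lemma lookup_sum_single:
  assumes "finite S"
  shows "Poly_Mapping.lookup (\<Sum>i\<in>S. Poly_Mapping.single i (1::nat)) j = (if j \<in> S then 1 else 0)"
  using assms by (simp add: lookup_sum lookup_single when_def)

lemma keys_sum_single:
  assumes "finite S"
  shows "Poly_Mapping.keys (\<Sum>i\<in>S. Poly_Mapping.single i (1::nat)) = S"
  using assms by (auto simp: in_keys_iff lookup_sum_single simp del: One_nat_def split: if_splits)

lemma msubst_monomial:
  assumes "finite S"
  shows "msubst \<sigma> (cst c * m_BD S) = cst c * (\<Prod>i\<in>S. \<sigma> i)"
proof -
  define e where "e = (\<Sum>i\<in>S. Poly_Mapping.single i (1::nat))"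
  have e: "Poly_Mapping.lookup e i = 1" if "i \<in> S" for i
    using that assms unfolding e_def by (simp only: lookup_sum_single if_True)
  have keys: "Poly_Mapping.keys e = S"
    using assms unfolding e_def by (rule keys_sum_single)
  have "cst c * m_BD S = Poly_Mapping.single e c"
    by (simp add: cst_def m_BD_eq_single mult_single e_def)
  then have "msubst \<sigma> (cst c * m_BD S) =
      cst c * (\<Prod>i\<in>S. \<sigma> i ^ Poly_Mapping.lookup e i)"
    by (subst msubst_superset[of "{e}"]) (simp_all add: keys)
  also have "(\<Prod>i\<in>S. \<sigma> i ^ Poly_Mapping.lookup e i) = (\<Prod>i\<in>S. \<sigma> i)"
    by (intro prod.cong) (simp_all add: e)
  finally show ?thesis .
qed

text \<open>
  Scaling the variables in \<open>T\<close> by \<open>t\<close> has the monomials \<open>m\<^sub>S\<close> as eigenvectors: each of the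
  variables is raised to the first power only, so the eigenvalue just counts \<open>S \<inter> T\<close>.
\<close>

lemma msubst_scale_monomial:
  assumes "finite S"
  shows "msubst (\<lambda>j. if j \<in> T then cst t * xvar j else xvar j) (cst c * m_BD S) =
         cst (t ^ card (S \<inter> T)) * (cst c * m_BD S)"
proof -
  have "(\<Prod>j\<in>S. if j \<in> T then cst t * xvar j else xvar j) =
        (\<Prod>j\<in>S. (if j \<in> T then cst t else 1) * xvar j)"
    by (intro prod.cong) simp_all
  also have "\<dots> = cst (t ^ card (S \<inter> T)) * m_BD S"
    using assms
    by (simp add: prod.distrib m_BD_def cst_power prod.If_cases Int_def)
  finally show ?thesis
    using assms by (simp add: msubst_monomial mult_ac)
qed

section \<open>Assignments and bar diagrams\<close>

definition assignments :: "nat \<Rightarrow> int set set" where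
  "assignments n = {S. S \<subseteq> {-1..int n} \<and> (-1 \<in> S \<longleftrightarrow> 0 \<notin> S)}"

lemma finite_assignments: "finite (assignments n)"
  by (rule finite_subset[of _ "Pow {-1..int n}"]) (auto simp: assignments_def)

lemma finite_assignment: "S \<in> assignments n \<Longrightarrow> finite S"
  by (auto simp: assignments_def intro: finite_subset)

lemma next_notin_assignment: "S \<in> assignments n \<Longrightarrow> int n + 1 \<notin> S"
  by (auto simp: assignments_def)

lemma assignments_0: "assignments 0 = {{-1}, {0}}"
proof -
  have "S = {-1} \<or> S = {0}" if "S \<in> assignments 0" for S
  proof -
    from that have "S \<subseteq> {-1, 0}" "-1 \<in> S \<longleftrightarrow> 0 \<notin> S"
      by (auto simp: assignments_def subset_iff)
    then show ?thesis by blast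
  qed
  then have "assignments 0 \<subseteq> {{-1}, {0}}"
    by blast
  moreover have "{-1} \<in> assignments 0" "{0} \<in> assignments 0"
    by (simp_all add: assignments_def)
  ultimately show ?thesis by blast
qed

lemma assignments_Suc:
  "assignments (Suc n) = assignments n \<union> insert (int n + 1) ` assignments n"
proof (intro equalityI subsetI)
  fix S assume S: "S \<in> assignments (Suc n)"
  then have "S - {int n + 1} \<in> assignments n"
    by (auto simp: assignments_def)
  then show "S \<in> assignments n \<union> insert (int n + 1) ` assignments n"
    by (cases "int n + 1 \<in> S") (auto intro!: image_eqI[of _ _ "S - {int n + 1}"])
next
  fix S assume "S \<in> assignments n \<union> insert (int n + 1) ` assignments n"
  then show "S \<in> assignments (Suc n)"
    by (auto simp: assignments_def subset_iff)
qed

lemma sum_assignments_Suc: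
  "(\<Sum>S\<in>assignments (Suc n). f S) =
   (\<Sum>S\<in>assignments n. f S + f (insert (int n + 1) S))"
proof -
  have "inj_on (insert (int n + 1)) (assignments n)"
    by (rule inj_onI) (metis insert_ident next_notin_assignment)
  moreover have "assignments n \<inter> insert (int n + 1) ` assignments n = {}"
    using next_notin_assignment by blast
  ultimately show ?thesis
    by (simp add: assignments_Suc sum.union_disjoint finite_assignments sum.reindex sum.distrib)
qed

text \<open>An assignment that is not a bar diagram has a bar whose factor in \<open>A\<close> is an empty sum.\<close>

lemma sum_bar_diagrams_eq_assignments:
  "(\<Sum>S\<in>bar_diagrams W. cst (of_qpoly (A_BD W S)) * m_BD S) =
   (\<Sum>S\<in>assignments (length W). cst (of_qpoly (A_BD W S)) * m_BD S)"
proof (rule sum.mono_neutral_left)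
  show "bar_diagrams W \<subseteq> assignments (length W)"
    by (auto simp: bar_diagrams_def assignments_def)
  have "A_BD W S = 0" if "S \<in> assignments (length W) - bar_diagrams W" for S
  proof -
    from that obtain i where i: "i \<in> {1..length W}" and "yellow W S i = {}"
      unfolding bar_diagrams_def assignments_def by blast
    then have "(\<Sum>e\<in>yellow W S i. qpoly ^ e) = 0"
      by simp
    with i have "(\<Prod>i = 1..length W. \<Sum>e\<in>yellow W S i. qpoly ^ e) = 0"
      by (intro prod_zero) auto
    then show ?thesis
      by (simp add: A_BD_def)
  qed
  then show "\<forall>S\<in>assignments (length W) - bar_diagrams W.
      cst (of_qpoly (A_BD W S)) * m_BD S = 0"
    by simp
qed (rule finite_assignments)

section \<open>Appending a bar\<close>

text \<open>
  Bars only act on earlier bars, so neither the new entry nor the state of the new bar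
  affects the yellow cells of the old bars.
\<close>

lemma yellow_append_old:
  assumes "i \<in> {1..length W}"
  shows "yellow (W @ [w]) S i = yellow W S i"
    and "yellow W (insert (int (length W) + 1) S) i = yellow W S i"
  using assms by (auto simp: yellow_def up_count_def nth_append Int_insert_left)

lemma A_BD_append:
  "A_BD (W @ [w]) S = A_BD W S * (\<Sum>e\<in>yellow (W @ [w]) S (Suc (length W)). qpoly ^ e)"
  by (simp add: A_BD_def yellow_append_old algebra_simps)

lemma A_BD_insert_next: "A_BD W (insert (int (length W) + 1) S) = A_BD W S"
  by (simp add: A_BD_def yellow_append_old)

lemma yellow_append_new:
  fixes W :: "nat list" and w :: nat and S :: "int set"
  defines "k \<equiv> int (length W) + 1"
  defines "a \<equiv> card (S \<inter> {k - int w..k - 1})"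
  assumes "k \<notin> S"
  shows "yellow (W @ [w]) S (Suc (length W)) = {a..<w}"
    and "yellow (W @ [w]) (insert k S) (Suc (length W)) = {0..<a}"
  using assms by (auto simp: yellow_def up_count_def Int_insert_left add.commute)

text \<open>
  Here the recursion meets the yellow cells: \<open>C\<close> is the weighted monomial of an assignment of the
  old bars, \<open>a\<close> the number of up bars seen by the new one, and the two terms on the right belong
  to the extensions with the new bar \<open>x\<close> down and up.
\<close>

lemma recursion_on_monomial:
  fixes x C :: mpoly
  assumes "a \<le> w"
  shows "(x - cst (qvar ^ w)) * cst (1 / (1 - qvar)) * C +
           (1 - x) * cst (1 / (1 - qvar)) * (cst (qvar ^ a) * C) =
         cst (of_qpoly (\<Sum>e = a..<w. qpoly ^ e)) * C +
           x * (cst (of_qpoly (\<Sum>e = 0..<a. qpoly ^ e)) * C)"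
  unfolding of_qpoly_geometric_sum[OF assms] of_qpoly_geometric_sum[OF le0]
    cst_mult cst_diff power_0 cst_1
  by (simp only: algebra_simps mult_1_left mult_1_right)

lemma P_W_eq_sum_assignments:
  "P_W W = (\<Sum>S\<in>assignments (length W). cst (of_qpoly (A_BD W S)) * m_BD S)"
proof (induction W rule: rev_induct)
  case Nil
  show ?case
    by (simp add: P_W_Nil assignments_0 A_BD_def m_BD_def qvar_def)
next
  case (snoc w W)
  define k where "k = int (length W) + 1"
  define C where "C = (\<lambda>S. cst (of_qpoly (A_BD W S)) * m_BD S)"
  define T where "T = {k - int w..k - 1}"
  define r where "r = cst (1 / (1 - qvar))"
  define u where "u = (\<lambda>S. cst (of_qpoly (A_BD (W @ [w]) S)) * m_BD S)"
  have IH: "P_W W = (\<Sum>S\<in>assignments (length W). C S)"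
    using snoc by (simp add: C_def)
  have scale: "(\<lambda>j. if k - int w \<le> j \<and> j \<le> k - 1 then cst qvar * xvar j else xvar j) =
               (\<lambda>j. if j \<in> T then cst qvar * xvar j else xvar j)"
    by (simp add: T_def)
  have "P_W (W @ [w]) =
      (xvar k - cst (qvar ^ w)) * r * (\<Sum>S\<in>assignments (length W). C S) +
      (1 - xvar k) * r *
        (\<Sum>S\<in>assignments (length W). msubst (\<lambda>j. if j \<in> T then cst qvar * xvar j else xvar j) (C S))"
    by (simp only: P_W_append[OF k_def] IH scale msubst_sum r_def)
  also have "\<dots> = (\<Sum>S\<in>assignments (length W).
      (xvar k - cst (qvar ^ w)) * r * C S +
      (1 - xvar k) * r * msubst (\<lambda>j. if j \<in> T then cst qvar * xvar j else xvar j) (C S))"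
    by (simp only: sum_distrib_left sum.distrib)
  also have "\<dots> = (\<Sum>S\<in>assignments (length W). u S + u (insert k S))"
  proof (rule sum.cong)
    fix S assume S: "S \<in> assignments (length W)"
    define a where "a = card (S \<inter> T)"
    have fin: "finite S" and new: "k \<notin> S"
      using S finite_assignment next_notin_assignment by (auto simp: k_def)
    \<comment> \<open>The new bar acts on exactly \<open>w\<close> positions, so it sees at most \<open>w\<close> up bars.\<close>
    have "a \<le> card T"
      unfolding a_def by (rule card_mono) (auto simp: T_def)
    then have "a \<le> w"
      by (simp add: T_def)
    have down: "u S = cst (of_qpoly (\<Sum>e = a..<w. qpoly ^ e)) * C S"
      using yellow_append_new(1)[of W S w] new
      by (simp add: u_def C_def A_BD_append of_qpoly_mult cst_mult a_def T_def k_def mult_ac)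
    have "m_BD (insert k S) = xvar k * m_BD S"
      using fin new by (simp add: m_BD_def)
    then have up: "u (insert k S) = xvar k * (cst (of_qpoly (\<Sum>e = 0..<a. qpoly ^ e)) * C S)"
      using yellow_append_new(2)[of W S w] new A_BD_insert_next[of W S]
      by (simp add: u_def C_def A_BD_append of_qpoly_mult cst_mult a_def T_def k_def mult_ac)
    show "(xvar k - cst (qvar ^ w)) * r * C S +
        (1 - xvar k) * r * msubst (\<lambda>j. if j \<in> T then cst qvar * xvar j else xvar j) (C S) =
      u S + u (insert k S)"
      using recursion_on_monomial[OF \<open>a \<le> w\<close>, of "xvar k" "C S"]
        msubst_scale_monomial[OF fin, of T qvar "of_qpoly (A_BD W S)"]
      by (simp only: up down r_def a_def C_def)
  qed simp
  also have "\<dots> = (\<Sum>S\<in>assignments (length (W @ [w])). u S)"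
    by (simp add: sum_assignments_Suc k_def)
  finally show ?case
    by (simp only: u_def)
qed

theorem theorem1p1:
  fixes W :: "nat list"
  assumes "legal W"
  shows "P_W W = (\<Sum>S\<in>bar_diagrams W. cst (of_qpoly (A_BD W S)) * m_BD S)"
  by (simp only: P_W_eq_sum_assignments sum_bar_diagrams_eq_assignments)

end
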